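(* Let $\mathbf{w}\in\mathbb{R}^P$, $P\ge N$, be the parameters of a (possibly nonlinear) classifier with logits $\mathbf{s}=s(X;\mathbf{w})\in\mathbb{R}^N$ on $N$ training inputs. If $\mathbf{w}_t$ follows natural gradient flow on the logistic loss with labels $\mathbf{y}\in\{-1,+1\}^N$, and the Jacobian $J_t=\frac{\partial\mathbf{s}_t}{\partial\mathbf{w}_t}\in\mathbb{R}^{N\times P}$, where $\mathbf{s}_t=s(X;\mathbf{w}_t)$, is of full rank, then $\mathbf{s}_t$ grows asymptotically linearly with direction vector $\mathbf{y}$.
   Context: $X=(\mathbf{x}_1\cdots\mathbf{x}_N)^\top$ collects the training inputs, and $s(X;\mathbf{w})=(s_1,\dots,s_N)^\top$, where $s_n\in\mathbb{R}$ is the logit (real-valued model output) at input $\mathbf{x}_n$ and depends smoothly on $\mathbf{w}$. The classifier defines the probabilistic model in which, given the inputs, the labels are independent with $p(y_n\mid\mathbf{x}_n,\mathbf{w})=\frac{1}{1+e^{-y_ns_n}}$ for $y_n\in\{-1,+1\}$. The logistic loss is $\mathcal{L}(\mathbf{w})=-\sum_{n=1}^N\log p(y_n\mid\mathbf{x}_n,\mathbf{w})=\sum_{n=1}^N\log(1+e^{-y_ns_n})$. The Fisher information matrix, computed on the training inputs, is $F(\mathbf{w})=\mathbb{E}\left[\nabla_{\mathbf{w}}\mathcal{L}\,\nabla_{\mathbf{w}}\mathcal{L}^\top\right]$, where the expectation is over labels drawn from the model $p(\cdot\mid\mathbf{x}_n,\mathbf{w})$, $n=1,\dots,N$ (so that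 with respect to the logits it is the diagonal matrix with entries $\phi(s_i)(1-\phi(s_i))$, $\phi(u)=1/(1+e^{-u})$, and $F(\mathbf{w})=J^\top F(\mathbf{s})J$). $F(\mathbf{w})$ need not be invertible; natural gradient flow is any trajectory $\mathbf{w}_t$ satisfying $F(\mathbf{w}_t)\dot{\mathbf{w}}_t=-\nabla_{\mathbf{w}}\mathcal{L}(\mathbf{w}_t)$. *)

theory Defs
  imports "HOL-Analysis.Analysis" "HOL-Probability.Probability"
begin

definition gradient :: "(real^'p \<Rightarrow> real) \<Rightarrow> real^'p \<Rightarrow> real^'p" where
  "gradient g w = (\<chi> i. frechet_derivative g (at w) (axis i 1))"

text \<open>
  The class \<open>C\<^sup>k\<close> on the whole space, by recursion on the partial derivatives.
\<close>

fun Ck :: "nat \<Rightarrow> (real^'p \<Rightarrow> real) \<Rightarrow> bool" where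
  "Ck 0 g \<longleftrightarrow> continuous_on UNIV g"
| "Ck (Suc k) g \<longleftrightarrow> (\<forall>w. g differentiable (at w)) \<and> (\<forall>i. Ck k (\<lambda>w. gradient g w $ i))"

definition smooth :: "(real^'p \<Rightarrow> real) \<Rightarrow> bool" where
  "smooth g \<longleftrightarrow> (\<forall>k. Ck k g)"

text \<open>
  A classifier is a map \<open>f\<close> taking an input and a parameter vector to a real logit. The rows of
  \<open>X\<close> are the training inputs, so that \<open>X $ n\<close> is the \<open>n\<close>-th input.
\<close>

definition logits ::
  "(real^'d \<Rightarrow> real^'p \<Rightarrow> real) \<Rightarrow> real^'d^'n \<Rightarrow> real^'p \<Rightarrow> real^'n" where
  "logits f X w = (\<chi> n. f (X $ n) w)"

definition label_prob :: "real \<Rightarrow> real \<Rightarrow> real" where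
  "label_prob y s = 1 / (1 + exp (- y * s))"

text \<open>
  The distribution of a single label in \<open>{-1, +1}\<close> given its logit; the lemma below shows that its
  mass function is \<^const>\<open>label_prob\<close>.
\<close>

definition label_pmf :: "real \<Rightarrow> real pmf" where
  "label_pmf s = map_pmf (\<lambda>b. if b then 1 else -1) (bernoulli_pmf (label_prob 1 s))"

lemma pmf_label_pmf:
  assumes "y \<in> {-1, 1}"
  shows "pmf (label_pmf s) y = label_prob y s"
proof -
  let ?g = "\<lambda>b. if b then 1 else -1 :: real"
  have inj: "inj ?g" by (auto simp: inj_def)
  have "0 \<le> label_prob 1 s" "label_prob 1 s \<le> 1"
    by (simp_all add: label_prob_def add_pos_pos)
  then have "pmf (label_pmf s) (?g True) = label_prob 1 s"
    "pmf (label_pmf s) (?g False) = 1 - label_prob 1 s"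
    unfolding label_pmf_def pmf_map_inj'[OF inj] by simp_all
  moreover have "1 - label_prob 1 s = label_prob (-1) s"
  proof -
    have "1 + exp s \<noteq> 0" using exp_gt_zero[of s] by linarith
    then show ?thesis by (simp add: label_prob_def exp_minus field_simps)
  qed
  ultimately show ?thesis using assms by auto
qed

text \<open>
  The joint distribution of the label vector: independent labels given the inputs. The second
  argument of \<^const>\<open>Pi_pmf\<close> is the value outside the index set, which is irrelevant for
  \<^const>\<open>UNIV\<close>.
\<close>

definition labels_pmf ::
  "(real^'d \<Rightarrow> real^'p \<Rightarrow> real) \<Rightarrow> real^'d^'n \<Rightarrow> real^'p \<Rightarrow> (real^'n) pmf" where
  "labels_pmf f X w = map_pmf vec_lambda (Pi_pmf UNIV 0 (\<lambda>n. label_pmf (f (X $ n) w)))"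

definition logistic_loss ::
  "(real^'d \<Rightarrow> real^'p \<Rightarrow> real) \<Rightarrow> real^'d^'n \<Rightarrow> real^'n \<Rightarrow> real^'p \<Rightarrow> real" where
  "logistic_loss f X y w = - (\<Sum>n\<in>UNIV. ln (label_prob (y $ n) (f (X $ n) w)))"

definition outer :: "real^'p \<Rightarrow> real^'p \<Rightarrow> real^'p^'p" where
  "outer u v = (\<chi> i j. u $ i * v $ j)"

text \<open>
  The labels over which the expectation is taken are drawn from the model at \<open>w\<close>; this \<open>w\<close> is held
  fixed when the gradient is formed, and the observed labels do not enter.
\<close>

definition fisher ::
  "(real^'d \<Rightarrow> real^'p \<Rightarrow> real) \<Rightarrow> real^'d^'n \<Rightarrow> real^'p \<Rightarrow> real^'p^'p" where
  "fisher f X w = measure_pmf.expectation (labels_pmf f X w)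
     (\<lambda>y. outer (gradient (logistic_loss f X y) w) (gradient (logistic_loss f X y) w))"

text \<open>
  The Fisher matrix may be singular, so the flow is the implicit equation \<open>F(w) w' = - \<nabla>L(w)\<close>
  rather than one solved for \<open>w'\<close>. The derivative at time \<open>0\<close> is one-sided.
\<close>

definition natural_gradient_flow ::
  "(real^'d \<Rightarrow> real^'p \<Rightarrow> real) \<Rightarrow> real^'d^'n \<Rightarrow> real^'n \<Rightarrow> (real \<Rightarrow> real^'p) \<Rightarrow> bool" where
  "natural_gradient_flow f X y w \<longleftrightarrow>
     (\<forall>t\<ge>0. \<exists>w'. (w has_vector_derivative w') (at t within {0..}) \<and>
        fisher f X (w t) *v w' = - gradient (logistic_loss f X y) (w t))"

definition full_rank :: "real^'p^'n \<Rightarrow> bool" where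
  "full_rank A \<longleftrightarrow> rank A = min CARD('n) CARD('p)"

text \<open>
  Asymptotically linear growth with direction vector \<open>v\<close>: the curve approaches a line
  \<open>t \<mapsto> b + t v\<close>. In particular \<open>s t / t\<close> tends to \<open>v\<close>.
\<close>

definition asymptotically_linear ::
  "(real \<Rightarrow> 'a::real_normed_vector) \<Rightarrow> 'a \<Rightarrow> bool" where
  "asymptotically_linear s v \<longleftrightarrow> (\<exists>b. ((\<lambda>t. s t - (b + t *\<^sub>R v)) \<longlongrightarrow> 0) at_top)"

end

theory Submission
  imports Defs
begin

text \<open>
  In logit space the flow decouples: each margin \<open>a = y\<^sub>n s\<^sub>n\<close> satisfies \<open>a' = 1 + exp (- a)\<close>.
  Hence \<open>(1 + exp a) exp (- t)\<close> is conserved, so \<open>a - t = ln (1 + exp (a 0) - exp (- t))\<close> converges.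
\<close>

section \<open>Derivatives of the logits and of the loss\<close>

lemma smooth_imp_differentiable:
  assumes "smooth g"
  shows "g differentiable (at w)"
  using assms Ck.simps(2)[of 0 g] unfolding smooth_def by blast

text \<open>Componentwise differentiability assembles into differentiability of the vector of
  logits, so the rows of one Jacobian serve in every later chain rule.\<close>

lemma has_derivative_logits_nth:
  assumes "\<And>n. f (X $ n) differentiable (at w)"
  shows "(f (X $ n) has_derivative (\<lambda>v. (jacobian (logits f X) (at w) *v v) $ n)) (at w)"
proof -
  have "(logits f X has_derivative (\<lambda>v. \<chi> n. frechet_derivative (f (X $ n)) (at w) v)) (at w)"
    unfolding logits_def
    using assms frechet_derivative_works
    by (subst has_derivative_componentwise_within)
       (auto simp: Basis_vec_def inner_axis)
  then have "logits f X differentiable (at w)"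
    by (auto simp: differentiable_def)
  then have "(logits f X has_derivative ((*v) (jacobian (logits f X) (at w)))) (at w)"
    by (simp add: jacobian_works)
  from bounded_linear.has_derivative[OF bounded_linear_vec_nth this, of n]
  show ?thesis by (simp add: logits_def)
qed

text \<open>Chain rule: the log-likelihood \<open>- ln (1 + exp (- y s))\<close> has derivative
  \<open>y / (1 + exp (y s))\<close> in the logit, and the Jacobian pulls it back to the parameters.
  Labels are arbitrary reals, so the formula can be substituted under an expectation without regard
  to the support.\<close>

lemma gradient_logistic_loss:
  assumes "\<And>n. f (X $ n) differentiable (at w)"
  shows "gradient (logistic_loss f X y) w =
    - (transpose (jacobian (logits f X) (at w)) *v
        (\<chi> n. y $ n / (1 + exp (y $ n * f (X $ n) w))))"
proof -
  let ?J = "jacobian (logits f X) (at w)"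
  let ?h = "\<lambda>n. y $ n / (1 + exp (y $ n * f (X $ n) w))"
  have pos: "1 + exp x > 0" for x :: real
    by (simp add: add_pos_pos)
  have "((\<lambda>w. ln (label_prob (y $ n) (f (X $ n) w))) has_derivative (\<lambda>v. ?h n * (?J *v v) $ n)) (at w)" for n
  proof -
    have "(\<lambda>w. ln (label_prob (y $ n) (f (X $ n) w))) = (\<lambda>w. - ln (1 + exp (- (y $ n * f (X $ n) w))))"
      using pos by (auto simp: label_prob_def ln_div)
    moreover have "((\<lambda>w. - ln (1 + exp (- (y $ n * f (X $ n) w)))) has_derivative
        (\<lambda>v. ?h n * (?J *v v) $ n)) (at w)"
    proof -
      have "((\<lambda>u. - ln (1 + exp (- (c * u)))) has_real_derivative c / (1 + exp (c * u))) (at u)" for c u :: real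
      proof -
        \<comment> \<open>The left side is what differentiation yields; expanding by
          \<open>exp x\<close> gives the right side.\<close>
        have "c * exp (- x) / (1 + exp (- x)) = c / (1 + exp x)" for x :: real
          using pos[of x] pos[of "- x"] by (simp add: frac_eq_eq algebra_simps flip: exp_add)
        from this[of "c * u"] show ?thesis
          using pos[of "- (c * u)"] by (auto intro!: derivative_eq_intros simp: mult_ac)
      qed
      from has_derivative_compose[OF has_derivative_logits_nth[where f=f and X=X, OF assms, of n]
          this[unfolded has_field_derivative_def]]
      show ?thesis .
    qed
    ultimately show ?thesis by simp
  qed
  then have "(logistic_loss f X y has_derivative (\<lambda>v. - (\<Sum>n\<in>UNIV. ?h n * (?J *v v) $ n))) (at w)"
    unfolding logistic_loss_def by (intro derivative_intros)
  from frechet_derivative_at[OF this, symmetric]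
  have "frechet_derivative (logistic_loss f X y) (at w) = (\<lambda>v. - (\<Sum>n\<in>UNIV. ?h n * (?J *v v) $ n))" .
  moreover have J: "(?J *v axis i 1) $ n = ?J $ n $ i" for i n
    by (simp add: matrix_vector_mult_basis column_def)
  moreover have T: "(transpose ?J *v u) $ i = (\<Sum>n\<in>UNIV. u $ n * ?J $ n $ i)" for u i
    by (simp add: matrix_vector_mult_def transpose_def mult.commute)
  ultimately show ?thesis
    by (simp add: gradient_def vec_eq_iff J T)
qed

section \<open>Expectations over labels and the Fisher matrix\<close>

text \<open>
  The library's \<open>expectation_prod_Pi_pmf\<close> requires nonnegative factors, but scores have mean zero.
\<close>

lemma expectation_prod_Pi_pmf':
  fixes g :: "'a \<Rightarrow> 'b \<Rightarrow> 'c :: {real_normed_field, banach, second_countable_topology}"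
  assumes "finite A"
    and int: "\<And>x. x \<in> A \<Longrightarrow> integrable (measure_pmf (p x)) (g x)"
  shows "measure_pmf.expectation (Pi_pmf A d p) (\<lambda>y. \<Prod>x\<in>A. g x (y x)) =
    (\<Prod>x\<in>A. measure_pmf.expectation (p x) (g x))"
proof -
  have marginal: "p x = map_pmf (\<lambda>y. y x) (Pi_pmf A d p)" if "x \<in> A" for x
    using that \<open>finite A\<close> by (simp add: Pi_pmf_component)
  have "measure_pmf.expectation (Pi_pmf A d p) (\<lambda>y. \<Prod>x\<in>A. g x (y x)) =
      (\<Prod>x\<in>A. measure_pmf.expectation (Pi_pmf A d p) (\<lambda>y. g x (y x)))"
  proof (rule prob_space.indep_vars_lebesgue_integral[OF measure_pmf.prob_space_axioms \<open>finite A\<close>])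
    show "prob_space.indep_vars (Pi_pmf A d p) (\<lambda>_. borel) (\<lambda>x y. g x (y x)) A"
      by (rule prob_space.indep_vars_compose2[OF measure_pmf.prob_space_axioms indep_vars_Pi_pmf[OF \<open>finite A\<close>]]) simp
    show "integrable (measure_pmf (Pi_pmf A d p)) (\<lambda>y. g x (y x))" if "x \<in> A" for x
      using int[OF that] by (subst (asm) marginal[OF that]) (simp add: integrable_map_pmf_eq)
  qed
  also have "\<dots> = (\<Prod>x\<in>A. measure_pmf.expectation (p x) (g x))"
    by (intro prod.cong refl) (subst marginal, auto)
  finally show ?thesis .
qed

lemma expectation_label_pmf:
  fixes g :: "real \<Rightarrow> real"
  shows "measure_pmf.expectation (label_pmf s) g = label_prob 1 s * g 1 + label_prob (- 1) s * g (- 1)"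
proof -
  have "set_pmf (label_pmf s) \<subseteq> {1, -1}" by (auto simp: label_pmf_def)
  then show ?thesis
    by (subst integral_measure_pmf[of "{1, -1}"]) (auto simp: pmf_label_pmf)
qed

lemma finite_set_labels_pmf: "finite (set_pmf (labels_pmf f X w))"
proof -
  have "finite (set_pmf (label_pmf s))" for s
    by (simp add: label_pmf_def)
  then show ?thesis
    unfolding labels_pmf_def by (auto simp: set_Pi_pmf intro!: finite_imageI finite_PiE_dflt)
qed

text \<open>The score of a logit is \<open>1 - p\<close> at label 1 and \<open>- p\<close> at label
  -1, where \<open>p = label_prob 1 s\<close>. It has mean 0 and second moment
  \<open>p (1 - p)\<close>, so independence makes the logit-space Fisher matrix diagonal.\<close>

lemma expectation_label_scores:
  "measure_pmf.expectation (labels_pmf f X w)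
     (\<lambda>y. (y $ n / (1 + exp (y $ n * f (X $ n) w))) * (y $ m / (1 + exp (y $ m * f (X $ m) w)))) =
   (if n = m then label_prob 1 (f (X $ n) w) * (1 - label_prob 1 (f (X $ n) w)) else 0)"
  (is "measure_pmf.expectation _ (\<lambda>y. ?h n (y $ n) * ?h m (y $ m)) = _")
proof -
  have pos: "1 + exp x > 0" for x :: real
    by (simp add: add_pos_pos)
  have mean: "measure_pmf.expectation (label_pmf (f (X $ k) w)) (?h k) = 0" for k
    using pos[of "f (X $ k) w"] pos[of "- f (X $ k) w"]
    by (simp add: expectation_label_pmf label_prob_def)
  have var: "measure_pmf.expectation (label_pmf (f (X $ k) w)) (\<lambda>y. ?h k y * ?h k y) =
      label_prob 1 (f (X $ k) w) * (1 - label_prob 1 (f (X $ k) w))" for k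
  proof -
    have "exp (f (X $ k) w) > 0" by simp
    moreover from this have "1 + exp (f (X $ k) w) > 0" by linarith
    ultimately show ?thesis
      by (simp add: expectation_label_pmf label_prob_def exp_minus divide_simps) algebra
  qed
  \<comment> \<open>Padding with ones turns the two scores into a product over all coordinates; for
    \<open>n = m\<close> the single nontrivial factor is the square.\<close>
  let ?g = "\<lambda>k y. (if k = n then ?h k y else 1) * (if k = m then ?h k y else 1)"
  have int: "integrable (measure_pmf (label_pmf s)) g" for s and g :: "real \<Rightarrow> real"
    by (intro integrable_measure_pmf_finite) (simp add: label_pmf_def)
  have "measure_pmf.expectation (labels_pmf f X w) (\<lambda>y. ?h n (y $ n) * ?h m (y $ m)) =
      measure_pmf.expectation (Pi_pmf UNIV 0 (\<lambda>n. label_pmf (f (X $ n) w))) (\<lambda>y. \<Prod>k\<in>UNIV. ?g k (y k))"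
    unfolding labels_pmf_def by (simp add: prod.distrib)
  also have "\<dots> = (\<Prod>k\<in>UNIV. measure_pmf.expectation (label_pmf (f (X $ k) w)) (?g k))"
    using int by (intro expectation_prod_Pi_pmf') auto
  also have "\<dots> = (if n = m then label_prob 1 (f (X $ n) w) * (1 - label_prob 1 (f (X $ n) w)) else 0)"
  proof (cases "n = m")
    case True
    then have "measure_pmf.expectation (label_pmf (f (X $ k) w)) (?g k) =
      (if k = n then label_prob 1 (f (X $ n) w) * (1 - label_prob 1 (f (X $ n) w)) else 1)" for k
      using var[of n] by simp
    with True show ?thesis by simp
  next
    case False
    have "measure_pmf.expectation (label_pmf (f (X $ n) w)) (?g n) = 0"
      using False mean[of n] by simp
    then have "(\<Prod>k\<in>UNIV. measure_pmf.expectation (label_pmf (f (X $ k) w)) (?g k)) = 0"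
      by (intro prod_zero bexI[of _ n]) auto
    with False show ?thesis by simp
  qed
  finally show ?thesis .
qed

text \<open>Entrywise form of \<open>F(w) = J^T F(s) J\<close>: both gradients are
  \<open>- J^T\<close> applied to the scores, the signs cancel, and only the diagonal score moments
  survive.\<close>

lemma fisher_nth:
  assumes "\<And>n. f (X $ n) differentiable (at w)"
  shows "fisher f X w $ i $ j = (\<Sum>n\<in>UNIV. jacobian (logits f X) (at w) $ n $ i *
    (label_prob 1 (f (X $ n) w) * (1 - label_prob 1 (f (X $ n) w))) * jacobian (logits f X) (at w) $ n $ j)"
proof -
  let ?J = "jacobian (logits f X) (at w)"
  let ?p = "labels_pmf f X w"
  let ?G = "\<lambda>y. gradient (logistic_loss f X y) w"
  let ?h = "\<lambda>y n. y $ n / (1 + exp (y $ n * f (X $ n) w))"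
  \<comment> \<open>Finite support gives integrability; the general type covers both the
    matrix-valued integrand and its scalar entries.\<close>
  have int: "integrable (measure_pmf ?p) g" for g :: "_ \<Rightarrow> 'e::{banach, second_countable_topology}"
    by (intro integrable_measure_pmf_finite finite_set_labels_pmf)
  have "fisher f X w $ i $ j = measure_pmf.expectation ?p (\<lambda>y. outer (?G y) (?G y) $ i $ j)"
    unfolding fisher_def
    by (simp add: integral_bounded_linear[OF bounded_linear_vec_nth] int)
  also have "\<dots> = measure_pmf.expectation ?p
      (\<lambda>y. \<Sum>n\<in>UNIV. \<Sum>m\<in>UNIV. ?J $ n $ i * ?J $ m $ j * (?h y n * ?h y m))"
    by (simp add: outer_def gradient_logistic_loss[where f=f and X=X, OF assms] matrix_vector_mult_def transpose_def
        sum_product mult_ac)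
  also have "\<dots> = (\<Sum>n\<in>UNIV. \<Sum>m\<in>UNIV. ?J $ n $ i * ?J $ m $ j *
      measure_pmf.expectation ?p (\<lambda>y. ?h y n * ?h y m))"
    by (simp only: Bochner_Integration.integral_sum int integral_mult_right_zero)
  also have "\<dots> = (\<Sum>n\<in>UNIV. ?J $ n $ i *
    (label_prob 1 (f (X $ n) w) * (1 - label_prob 1 (f (X $ n) w))) * ?J $ n $ j)"
    unfolding expectation_label_scores by (simp add: if_distrib mult_ac cong: if_cong)
  finally show ?thesis .
qed

section \<open>Velocity of the logits along the flow\<close>

text \<open>
  Full row rank makes \<open>J\<^sup>T\<close> injective, so it cancels from \<open>J\<^sup>T D J w' = - J\<^sup>T \<nabla>\<^sub>s L\<close>.
\<close>

lemma natural_gradient_direction: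
  fixes f :: "real^'d \<Rightarrow> real^'p \<Rightarrow> real" and X :: "real^'d^'n" and y :: "real^'n"
  assumes "CARD('n) \<le> CARD('p)"
    and diff: "\<And>n. f (X $ n) differentiable (at w)"
    and y: "y $ n \<in> {-1, 1}"
    and rank: "full_rank (jacobian (logits f X) (at w))"
    and flow: "fisher f X w *v w' = - gradient (logistic_loss f X y) w"
  shows "(jacobian (logits f X) (at w) *v w') $ n = y $ n * (1 + exp (- (y $ n * f (X $ n) w)))"
proof -
  let ?J = "jacobian (logits f X) (at w)"
  let ?d = "\<lambda>n. label_prob 1 (f (X $ n) w) * (1 - label_prob 1 (f (X $ n) w))"
  let ?h = "\<lambda>n. y $ n / (1 + exp (y $ n * f (X $ n) w))"
  have "(fisher f X w *v w') $ i = (transpose ?J *v (\<chi> n. ?d n * (?J *v w') $ n)) $ i" for i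
  proof -
    have "(fisher f X w *v w') $ i = (\<Sum>j\<in>UNIV. \<Sum>n\<in>UNIV. ?J $ n $ i * ?d n * ?J $ n $ j * w' $ j)"
      by (simp add: matrix_vector_mult_def fisher_nth[where f=f and X=X, OF diff] sum_distrib_right)
    also have "\<dots> = (\<Sum>n\<in>UNIV. \<Sum>j\<in>UNIV. ?J $ n $ i * ?d n * ?J $ n $ j * w' $ j)"
      by (rule sum.swap)
    also have "\<dots> = (transpose ?J *v (\<chi> n. ?d n * (?J *v w') $ n)) $ i"
      by (simp add: matrix_vector_mult_def transpose_def sum_distrib_left mult_ac)
    finally show ?thesis .
  qed
  then have "transpose ?J *v (\<chi> n. ?d n * (?J *v w') $ n) = transpose ?J *v (\<chi> n. ?h n)"
    using flow by (simp add: gradient_logistic_loss[where f=f and X=X, OF diff] vec_eq_iff)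
  \<comment> \<open>Since N \<le> P, full rank means rank N, which is the number of columns of the
    transpose.\<close>
  moreover have "inj ((*v) (transpose ?J))"
    using rank assms(1) by (simp add: full_rank_def full_rank_injective[symmetric] rank_transpose)
  ultimately have "(\<chi> n. ?d n * (?J *v w') $ n) = (\<chi> n. ?h n)"
    by (rule injD[rotated])
  then have "?d n * (?J *v w') $ n = ?h n"
    by (simp add: vec_eq_iff)
  \<comment> \<open>With \<open>q = label_prob y s\<close> and \<open>y = 1\<close> or
    \<open>y = -1\<close>, the score is \<open>y (1 - q)\<close> and \<open>?d\<close> is
    \<open>q (1 - q)\<close>; their quotient is \<open>y / q\<close>.\<close>
  moreover have "?h n = ?d n * (y $ n * (1 + exp (- (y $ n * f (X $ n) w))))"
  proof -
    have "exp (f (X $ n) w) > 0" "1 + exp (f (X $ n) w) > 0" by (simp_all add: add_pos_pos)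
    then show ?thesis using y
      by (auto simp: label_prob_def exp_minus divide_simps)
  qed
  moreover have "?d n > 0"
  proof -
    have "0 < label_prob 1 (f (X $ n) w)" "label_prob 1 (f (X $ n) w) < 1"
      by (simp_all add: label_prob_def add_pos_pos)
    then show ?thesis by simp
  qed
  ultimately show ?thesis by (metis less_irrefl mult_cancel_left)
qed

section \<open>The scalar margin equation and the limit\<close>

lemma margin_ode_asymptotic:
  fixes a :: "real \<Rightarrow> real"
  assumes "\<And>t. t \<ge> 0 \<Longrightarrow> (a has_real_derivative (1 + exp (- a t))) (at t within {0..})"
  shows "((\<lambda>t. a t - t) \<longlongrightarrow> ln (1 + exp (a 0))) at_top"
proof -
  let ?C = "1 + exp (a 0)"
  have C: "?C > 1" by simp
  have const: "(1 + exp (a t)) * exp (- t) = ?C" if "t \<ge> 0" for t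
  proof -
    \<comment> \<open>The equation gives \<open>exp a * a' = exp a + 1\<close>, which cancels the
      derivative of \<open>exp (- t)\<close>.\<close>
    have "\<exists>c. \<forall>t\<in>{0..}. (1 + exp (a t)) * exp (- t) = c"
    proof (rule has_field_derivative_zero_constant)
      fix t :: real assume "t \<in> {0..}"
      then show "((\<lambda>t. (1 + exp (a t)) * exp (- t)) has_real_derivative 0) (at t within {0..})"
        using assms[of t]
        by (auto intro!: derivative_eq_intros simp: exp_minus field_simps)
    qed simp
    then obtain c where c: "\<And>t. t \<ge> 0 \<Longrightarrow> (1 + exp (a t)) * exp (- t) = c" by auto
    from c[OF that] c[of 0] show ?thesis by simp
  qed
  have "a t - t = ln (?C - exp (- t))" if "t \<ge> 0" for t
  proof -
    have "exp (a t - t) = ?C - exp (- t)"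
      using const[OF that] by (simp add: exp_diff exp_minus field_simps)
    then show ?thesis by (metis ln_exp)
  qed
  then have "\<forall>\<^sub>F t in at_top. ln (?C - exp (- t)) = a t - t"
    by (auto intro: eventually_at_top_linorderI[of 0])
  moreover have "((\<lambda>t::real. exp (- t)) \<longlongrightarrow> 0) at_top"
    by (intro filterlim_compose[OF exp_at_bot] filterlim_uminus_at_bot_at_top)
  \<comment> \<open>\<open>?C > 1\<close> keeps the limiting argument of \<open>ln\<close> away from
    0.\<close>
  then have "((\<lambda>t. ln (?C - exp (- t))) \<longlongrightarrow> ln (?C - 0)) at_top"
    using C by (intro tendsto_ln tendsto_diff tendsto_const) linarith+
  ultimately show ?thesis
    by (simp add: tendsto_cong)
qed

theorem theorem4:
  fixes f :: "real^'d \<Rightarrow> real^'p \<Rightarrow> real"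
    and X :: "real^'d^'n"
    and y :: "real^'n"
    and w :: "real \<Rightarrow> real^'p"
  assumes "CARD('n) \<le> CARD('p)"
    and "\<And>n. smooth (f (X $ n))"
    and "\<And>n. y $ n \<in> {-1, 1}"
    and "natural_gradient_flow f X y w"
    and "\<And>t. t \<ge> 0 \<Longrightarrow> full_rank (jacobian (logits f X) (at (w t)))"
  shows "asymptotically_linear (\<lambda>t. logits f X (w t)) y"
proof -
  have diff: "f (X $ n) differentiable (at v)" for n v
    using assms(2) by (rule smooth_imp_differentiable)
  \<comment> \<open>Multiplication by \<open>y $ n\<close> is thus its own inverse and passes
    between logits and margins.\<close>
  have sq: "y $ n * y $ n = 1" for n
    using assms(3)[of n] by auto
  define a where "a n t = y $ n * f (X $ n) (w t)" for n t
  \<comment> \<open>The intercept of the limiting line: the limit of \<open>a n t - t\<close>,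
    turned back into a logit.\<close>
  define b where "b = (\<chi> n. y $ n * ln (1 + exp (a n 0)))"
  have "(a n has_real_derivative (1 + exp (- a n t))) (at t within {0..})" if "t \<ge> 0" for n t
  proof -
    let ?J = "jacobian (logits f X) (at (w t))"
    obtain w' where w': "(w has_vector_derivative w') (at t within {0..})"
      and flow: "fisher f X (w t) *v w' = - gradient (logistic_loss f X y) (w t)"
      using assms(4) \<open>t \<ge> 0\<close> unfolding natural_gradient_flow_def by blast
    \<comment> \<open>The chain rule is applied within \<open>{0..}\<close> because the flow has
      only a one-sided derivative at time 0.\<close>
    have "((\<lambda>t. f (X $ n) (w t)) has_derivative (\<lambda>h. (?J *v (h *\<^sub>R w')) $ n)) (at t within {0..})"
      by (rule has_derivative_compose[OF w'[unfolded has_vector_derivative_def]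
            has_derivative_logits_nth[where f=f and X=X, OF diff]])
    then have "((\<lambda>t. f (X $ n) (w t)) has_real_derivative (?J *v w') $ n) (at t within {0..})"
      by (simp add: has_field_derivative_def matrix_vector_mult_scaleR mult.commute[of _ "_ $ n"])
    then have "(a n has_real_derivative y $ n * (?J *v w') $ n) (at t within {0..})"
      unfolding a_def by (rule DERIV_cmult)
    moreover have "y $ n * (?J *v w') $ n = 1 + exp (- a n t)"
      using natural_gradient_direction[where f=f and X=X, OF assms(1) diff assms(3) assms(5)[OF \<open>t \<ge> 0\<close>] flow, of n] sq[of n]
      by (simp add: a_def mult.assoc[symmetric])
    ultimately show ?thesis by simp
  qed
  then have lim: "((\<lambda>t. a n t - t) \<longlongrightarrow> ln (1 + exp (a n 0))) at_top" for n
    by (rule margin_ode_asymptotic)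
  have "((\<lambda>t. logits f X (w t) - (b + t *\<^sub>R y)) \<longlongrightarrow> 0) at_top"
  proof (rule vec_tendstoI)
    fix n
    have "(logits f X (w t) - (b + t *\<^sub>R y)) $ n = y $ n * ((a n t - t) - ln (1 + exp (a n 0)))" for t
      using sq[of n] by (simp add: logits_def b_def a_def right_diff_distrib mult.assoc[symmetric])
    moreover have "((\<lambda>t. y $ n * ((a n t - t) - ln (1 + exp (a n 0)))) \<longlongrightarrow> y $ n * 0) at_top"
      using lim[of n] by (intro tendsto_mult_left) (simp add: LIM_zero)
    ultimately show "((\<lambda>t. (logits f X (w t) - (b + t *\<^sub>R y)) $ n) \<longlongrightarrow> 0 $ n) at_top"
      by simp
  qed
  then show ?thesis unfolding asymptotically_linear_def by blast
qed

end
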